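(* There exist universal constants $A_1$ and $A_2$ such that the following holds. Let $E$ be a $\delta$-hyperbolic space, let $\gamma$ be a $(\lambda,c)$-quasi-geodesic in $E$, and let $\sigma$ be a geodesic segment connecting the endpoints of $\gamma$. Then $\gamma$ belongs to the $H$-neighborhood of $\sigma$ (every point of $\gamma$ is at distance at most $H$ from $\sigma$), where $$H=\lambda^2(A_1c+A_2\delta).$$
   Context: Write $|x-y|$ for the distance between points $x,y$. All $\delta$-hyperbolic spaces are assumed geodesic: a geodesic metric space is $\delta$-hyperbolic ($\delta\ge 0$) if every geodesic triangle is $\delta$-thin, i.e. every point of each side is at distance at most $\delta$ from the union of the two other sides. For $\lambda\ge 1$, $c\ge 0$, a map $f:E\to F$ between metric spaces is a $(\lambda,c)$-quasi-isometry if $\frac1\lambda|x-y|_E-c\le |f(x)-f(y)|_F\le \lambda|x-y|_E+c$ for all $x,y\in E$. A $(\lambda,c)$-quasi-geodesic in $F$ is a $(\lambda,c)$-quasi-isometry from a real interval $[0,l]$ to $F$ (not necessarily continuous); its endpoints are the images of $0$ and $l$. *)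

theory Defs
  imports "HOL-Analysis.Analysis"
begin

text \<open>
  Metric spaces are given by a carrier set and a distance function, as in the locale
  \<^locale>\<open>Metric_space\<close>, so that a formula can quantify over all metric spaces carried by
  subsets of a given type.
\<close>

definition dist_to_set :: "('a \<Rightarrow> 'a \<Rightarrow> real) \<Rightarrow> 'a \<Rightarrow> 'a set \<Rightarrow> real" where
  "dist_to_set d x S = (INF y\<in>S. d x y)"

definition geodesic_segment ::
    "'a set \<Rightarrow> ('a \<Rightarrow> 'a \<Rightarrow> real) \<Rightarrow> 'a \<Rightarrow> 'a \<Rightarrow> 'a set \<Rightarrow> bool" where
  "geodesic_segment E d x y S \<longleftrightarrow>
     (\<exists>L g. 0 \<le> L \<and> g \<in> {0..L} \<rightarrow> E \<and>
            (\<forall>s\<in>{0..L}. \<forall>t\<in>{0..L}. d (g s) (g t) = \<bar>s - t\<bar>) \<and>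
            g 0 = x \<and> g L = y \<and> S = g ` {0..L})"

definition geodesic_metric_space :: "'a set \<Rightarrow> ('a \<Rightarrow> 'a \<Rightarrow> real) \<Rightarrow> bool" where
  "geodesic_metric_space E d \<longleftrightarrow>
     Metric_space E d \<and> (\<forall>x\<in>E. \<forall>y\<in>E. \<exists>S. geodesic_segment E d x y S)"

definition thin_sides ::
    "('a \<Rightarrow> 'a \<Rightarrow> real) \<Rightarrow> real \<Rightarrow> 'a set \<Rightarrow> 'a set \<Rightarrow> 'a set \<Rightarrow> bool" where
  "thin_sides d \<delta> S1 S2 S3 \<longleftrightarrow>
     (\<forall>p\<in>S1. dist_to_set d p (S2 \<union> S3) \<le> \<delta>) \<and>
     (\<forall>p\<in>S2. dist_to_set d p (S3 \<union> S1) \<le> \<delta>) \<and>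
     (\<forall>p\<in>S3. dist_to_set d p (S1 \<union> S2) \<le> \<delta>)"

definition hyperbolic_space :: "real \<Rightarrow> 'a set \<Rightarrow> ('a \<Rightarrow> 'a \<Rightarrow> real) \<Rightarrow> bool" where
  "hyperbolic_space \<delta> E d \<longleftrightarrow>
     0 \<le> \<delta> \<and> geodesic_metric_space E d \<and>
     (\<forall>x\<in>E. \<forall>y\<in>E. \<forall>z\<in>E. \<forall>S1 S2 S3.
        geodesic_segment E d x y S1 \<longrightarrow> geodesic_segment E d y z S2 \<longrightarrow>
        geodesic_segment E d z x S3 \<longrightarrow> thin_sides d \<delta> S1 S2 S3)"

text \<open>As in the source, a quasi-isometry need not be coarsely surjective.\<close>

definition quasi_isometry ::
    "real \<Rightarrow> real \<Rightarrow> 'a set \<Rightarrow> ('a \<Rightarrow> 'a \<Rightarrow> real) \<Rightarrow> 'b set \<Rightarrow> ('b \<Rightarrow> 'b \<Rightarrow> real) \<Rightarrow>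
     ('a \<Rightarrow> 'b) \<Rightarrow> bool" where
  "quasi_isometry \<Lambda> c E dE F dF f \<longleftrightarrow>
     1 \<le> \<Lambda> \<and> 0 \<le> c \<and> f \<in> E \<rightarrow> F \<and>
     (\<forall>x\<in>E. \<forall>y\<in>E. 1 / \<Lambda> * dE x y - c \<le> dF (f x) (f y) \<and>
                     dF (f x) (f y) \<le> \<Lambda> * dE x y + c)"

definition quasi_geodesic ::
    "real \<Rightarrow> real \<Rightarrow> 'a set \<Rightarrow> ('a \<Rightarrow> 'a \<Rightarrow> real) \<Rightarrow> real \<Rightarrow> (real \<Rightarrow> 'a) \<Rightarrow> bool" where
  "quasi_geodesic \<Lambda> c E d l \<gamma> \<longleftrightarrow>
     0 \<le> l \<and> quasi_isometry \<Lambda> c {0..l} (\<lambda>s t. \<bar>s - t\<bar>) E d \<gamma>"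

definition quasi_geodesics_near_geodesics ::
    "real \<Rightarrow> real \<Rightarrow> 'a set \<Rightarrow> ('a \<Rightarrow> 'a \<Rightarrow> real) \<Rightarrow> bool" where
  "quasi_geodesics_near_geodesics A1 A2 E d \<longleftrightarrow>
     (\<forall>\<delta> \<Lambda> c l \<gamma> \<sigma>.
        hyperbolic_space \<delta> E d \<longrightarrow> quasi_geodesic \<Lambda> c E d l \<gamma> \<longrightarrow>
        geodesic_segment E d (\<gamma> 0) (\<gamma> l) \<sigma> \<longrightarrow>
        (\<forall>t\<in>{0..l}. dist_to_set d (\<gamma> t) \<sigma> \<le> \<Lambda>\<^sup>2 * (A1 * c + A2 * \<delta>)))"

text \<open>
  The constants \<open>A1\<close> and \<open>A2\<close> of the theorem must not depend on the space, hence not on the type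
  of its points either. A formula cannot quantify over types below an existential quantifier, and
  \<open>\<exists>A1 A2. \<forall>(E :: 'a set) d. quasi_geodesics_near_geodesics A1 A2 E d\<close> alone would let the
  constants vary with \<open>'a\<close>. The theorem therefore asserts two things: constants exist
  for all spaces carried by sets of reals, and whatever constants serve those spaces also serve
  all spaces carried by subsets of an arbitrary type. Fixing one pair obtained from the
  first part, which mentions no type variable, gives the same two constants for every type.
\<close>

end

theory Submission
  imports Defs
begin

text \<open>
  Let \<open>(x|y)_w\<close> denote the Gromov product, which in a hyperbolic space is the distance from \<open>w\<close> to a
  segment from \<open>x\<close> to \<open>y\<close>, up to a multiple of \<open>\<delta>\<close>
  (\<open>dist_segment_le_gromov_product\<close>). The task is to bound the largest product \<open>R\<close> of two points of
  the quasi-geodesic at an intermediate point \<open>w\<close> by a multiple of \<open>\<Lambda>\<^sup>2 * e\<close>, where \<open>e\<close> is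
  \<open>3 * \<delta> + c\<close> for \<open>\<delta>\<close> increased slightly. This bound needs no geodesics, only the
  four-point inequality (\<open>hyperbolic_four_point\<close>).

  Take \<open>w\<close> where the product is almost maximal. The two halves of the quasi-geodesic leave \<open>w\<close>
  along the same segment of length \<open>R\<close>: seen from \<open>w\<close>, their far ends lie in the same direction up to
  depth \<open>R\<close>, and each half has to travel through all depths between \<open>0\<close> and \<open>R\<close>.
  Let \<open>m(s)\<close> be the least time between a
  point of depth \<open>s\<close> on one half and a point of depth \<open>s\<close> on the other. Such points are at distance
  at least about \<open>m(s) / \<Lambda>\<close> from each other, so one of them is at distance about \<open>m(s) / (2 * \<Lambda>)\<close>
  from the common segment. A path that far from the segment takes a time exponential in
  \<open>m(s) / (2 * \<Lambda> * e)\<close> to increase its depth by a fixed multiple of \<open>e\<close> (\<open>exponential_contraction\<close>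
  and \<open>crossing_time\<close>). Thus \<open>x = m(s) / (2 * \<Lambda> * e)\<close> satisfies a discrete form of the differential
  inequality \<open>x' \<ge> const / \<Lambda>\<^sup>2 * 2 powr x\<close> in the depth divided by \<open>e\<close> (\<open>depth_step\<close>). Its solutions
  explode after depth const \<open>* \<Lambda>\<^sup>2 * e\<close>. The explosion avoids the logarithmic factor that
  contraction at a single well chosen distance would give.

  A discrete recursion does not literally become infinite, and here the maximality of \<open>w\<close> enters:
  no point of either half has a product larger than about \<open>R\<close>, which bounds \<open>m(s)\<close> by a
  multiple of \<open>\<Lambda> * R\<close> for \<open>s\<close> close to \<open>R\<close>. The recursion outgrows this linear bound
  (\<open>blowup_outgrows_linear\<close>) unless \<open>R\<close> is at most a multiple of \<open>\<Lambda>\<^sup>2 * e\<close>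
  (\<open>branch_product_le\<close>).

  This argument works for carriers of any type. That constants which are valid for sets of reals
  are valid for every type is a separate statement, since the constants there are arbitrary. It
  follows by enclosing a given quasi-geodesic and geodesic in a geodesic subspace that has at most
  the cardinality of the continuum (\<open>near_geodesics_of_real_carriers\<close>).
\<close>

section \<open>Gromov products\<close>

text \<open>
  The places where a path leaves a region for the last time are found by this lemma. For a
  discontinuous path there is no exact exit time, only a short interval that contains it.
\<close>

lemma last_exit:
  fixes a b \<epsilon> :: real
  assumes "a \<le> b" "P a" "\<not> P b" "0 < \<epsilon>"
  obtains s t where "a \<le> s" "s \<le> t" "t \<le> b" "t - s \<le> \<epsilon>" "P s" "\<And>u. t \<le> u \<Longrightarrow> u \<le> b \<Longrightarrow> \<not> P u"
proof -
  define T where "T = {u. a \<le> u \<and> u \<le> b \<and> P u}"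
  define m where "m = Sup T"
  have T: "a \<in> T" "bdd_above T"
    using assms by (auto simp: T_def intro: bdd_aboveI[of _ b])
  have upper: "u \<le> m" if "u \<in> T" for u
    using that T(2) by (simp add: m_def cSup_upper)
  have "m - \<epsilon> / 2 < Sup T"
    using assms(4) by (simp add: m_def)
  then obtain s where s: "s \<in> T" "m - \<epsilon> / 2 < s"
    using T less_cSup_iff[of T "m - \<epsilon> / 2"] by blast
  have "s \<le> m" "m \<le> b"
    using upper[OF s(1)] T by (auto simp: m_def T_def intro!: cSup_least)
  show ?thesis
  proof (rule that[of s "min b (m + \<epsilon> / 2)"])
    show "\<not> P u" if u: "min b (m + \<epsilon> / 2) \<le> u" "u \<le> b" for u
    proof
      assume "P u"
      moreover have "a \<le> u" using u(1) upper[OF T(1)] assms(1,4) by linarith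
      ultimately have "u \<le> m" using upper u(2) by (simp add: T_def)
      then have "u = b" using u assms(4) by linarith
      with \<open>P u\<close> assms(3) show False by simp
    qed
  qed (use s \<open>s \<le> m\<close> \<open>m \<le> b\<close> assms(4) in \<open>auto simp: T_def\<close>)
qed

context Metric_space
begin

definition gromov_product :: "'a \<Rightarrow> 'a \<Rightarrow> 'a \<Rightarrow> real" where
  "gromov_product x y w = (d w x + d w y - d x y) / 2"

lemma gromov_product_commute: "gromov_product x y w = gromov_product y x w"
  by (simp add: gromov_product_def commute)

lemma gromov_product_le_dist:
  "\<lbrakk>x \<in> M; y \<in> M; w \<in> M\<rbrakk> \<Longrightarrow> gromov_product x y w \<le> d w x"
  using triangle[of w x y] by (simp add: gromov_product_def commute)

lemma gromov_product_base [simp]: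
  "\<lbrakk>y \<in> M; w \<in> M\<rbrakk> \<Longrightarrow> gromov_product w y w = 0"
  by (simp add: gromov_product_def)

lemma gromov_product_same [simp]: "x \<in> M \<Longrightarrow> gromov_product x x w = d w x"
  by (simp add: gromov_product_def)

lemma gromov_product_ge_dist_minus:
  "\<lbrakk>x \<in> M; y \<in> M; w \<in> M\<rbrakk> \<Longrightarrow> d w x - d x y \<le> gromov_product x y w"
  using triangle[of w y x] by (simp add: gromov_product_def commute)

lemma gromov_product_lipschitz:
  "\<lbrakk>x \<in> M; x' \<in> M; y \<in> M; w \<in> M\<rbrakk> \<Longrightarrow>
     gromov_product x y w \<le> gromov_product x' y w + d x x'"
  using triangle[of w x' x] triangle[of x' x y] by (simp add: gromov_product_def commute field_simps)

lemma dist_eq_gromov_products: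
  "d w x = gromov_product x y w + gromov_product w y x"
  by (simp add: gromov_product_def commute field_simps)

end

section \<open>From thin triangles to the four-point inequality\<close>

lemma (in Metric_space) geodesic_segmentE:
  assumes "geodesic_segment M d x y S"
  obtains L g where "0 \<le> L" "S = g ` {0..L}" "g 0 = x" "g L = y"
    "\<And>s. s \<in> {0..L} \<Longrightarrow> g s \<in> M"
    "\<And>s t. \<lbrakk>s \<in> {0..L}; t \<in> {0..L}\<rbrakk> \<Longrightarrow> d (g s) (g t) = \<bar>s - t\<bar>"
  using assms unfolding geodesic_segment_def by (metis Pi_iff)

lemma (in Metric_space) geodesic_segment_dist_add:
  assumes "geodesic_segment M d x y S" "p \<in> S"
  shows "d x p + d p y = d x y" "p \<in> M"
proof -
  obtain L g where g: "0 \<le> L" "S = g ` {0..L}" "g 0 = x" "g L = y"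
    "\<And>s. s \<in> {0..L} \<Longrightarrow> g s \<in> M"
    "\<And>s t. \<lbrakk>s \<in> {0..L}; t \<in> {0..L}\<rbrakk> \<Longrightarrow> d (g s) (g t) = \<bar>s - t\<bar>"
    using geodesic_segmentE[OF assms(1)] by blast
  obtain t where t: "t \<in> {0..L}" "p = g t"
    using assms(2) g(2) by auto
  have "d x p = t" "d p y = L - t" "d x y = L"
    using g(6)[of 0 t] g(6)[of t L] g(6)[of 0 L] t g(1,3,4) by auto
  then show "d x p + d p y = d x y" by simp
  show "p \<in> M" using g(5) t by blast
qed

lemma (in Metric_space) geodesic_segment_endpoints:
  assumes "geodesic_segment M d x y S"
  shows "x \<in> S" "y \<in> S" "x \<in> M" "y \<in> M"
  using assms unfolding geodesic_segment_def by force+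

lemma (in Metric_space) gromov_product_le_dist_segment:
  assumes "geodesic_segment M d x y S" "p \<in> S" "w \<in> M"
  shows "gromov_product x y w \<le> d w p"
  using geodesic_segment_dist_add[OF assms(1,2)] geodesic_segment_endpoints[OF assms(1)]
    triangle[of w p x] triangle[of w p y] assms(3)
  by (simp add: gromov_product_def commute)

lemma (in Metric_space) near_point_of_dist_to_set:
  assumes "dist_to_set d p S \<le> \<delta>" "\<delta> < \<delta>'" "S \<noteq> {}"
  obtains q where "q \<in> S" "d p q < \<delta>'"
proof -
  have "Inf (d p ` S) < \<delta>'" using assms by (simp add: dist_to_set_def)
  then show ?thesis
    using assms(3) that by (subst (asm) cInf_less_iff) (auto intro!: bdd_belowI[of _ 0])
qed

lemma (in Metric_space) dist_to_set_le:
  assumes "q \<in> S"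
  shows "dist_to_set d p S \<le> d p q"
  unfolding dist_to_set_def using assms by (auto intro!: cINF_lower bdd_belowI[of _ 0])

lemma hyperbolic_space_segment:
  assumes "hyperbolic_space \<delta> E d" "x \<in> E" "y \<in> E"
  obtains S where "geodesic_segment E d x y S"
  using assms unfolding hyperbolic_space_def geodesic_metric_space_def by blast

lemma hyperbolic_space_near_other_sides:
  assumes H: "hyperbolic_space \<delta> E d" and "\<delta> < \<delta>'"
    and S: "geodesic_segment E d x y S1" "geodesic_segment E d y z S2" "geodesic_segment E d z x S3"
    and "p \<in> S1"
  obtains q where "q \<in> S2 \<union> S3" "d p q < \<delta>'"
proof -
  interpret Metric_space E d
    using H by (simp add: hyperbolic_space_def geodesic_metric_space_def)
  have "thin_sides d \<delta> S1 S2 S3"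
    using H S geodesic_segment_endpoints[OF S(1)] geodesic_segment_endpoints[OF S(2)]
    unfolding hyperbolic_space_def by blast
  then have "dist_to_set d p (S2 \<union> S3) \<le> \<delta>"
    using \<open>p \<in> S1\<close> by (simp add: thin_sides_def)
  then show ?thesis
    using near_point_of_dist_to_set[of p "S2 \<union> S3" \<delta> \<delta>'] \<open>\<delta> < \<delta>'\<close> that
      geodesic_segment_endpoints[OF S(2)] by blast
qed

text \<open>
  The Gromov product at \<open>w\<close> measures the distance from \<open>w\<close> to a segment up to an additive error.
  Along the segment \<open>S\<close> the points start close to the side \<open>S3\<close> and end close to the side \<open>S2\<close>,
  so some point \<open>p\<close> is close to both; the broken lines from \<open>w\<close> to \<open>x\<close> and to \<open>y\<close> through \<open>p\<close> are
  then almost as short as the sides.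
\<close>

lemma dist_segment_le_gromov_product:
  assumes H: "hyperbolic_space \<delta> E d" and "\<delta> < \<delta>'"
    and S: "geodesic_segment E d x y S" and "w \<in> E"
  obtains p where "p \<in> S" "d w p \<le> Metric_space.gromov_product d x y w + 2 * \<delta>'"
proof -
  interpret Metric_space E d
    using H by (simp add: hyperbolic_space_def geodesic_metric_space_def)
  note xy = geodesic_segment_endpoints[OF S]
  obtain S2 where S2: "geodesic_segment E d y w S2"
    using hyperbolic_space_segment[OF H xy(4) \<open>w \<in> E\<close>] by blast
  obtain S3 where S3: "geodesic_segment E d w x S3"
    using hyperbolic_space_segment[OF H \<open>w \<in> E\<close> xy(3)] by blast
  obtain L g where g: "0 \<le> L" "S = g ` {0..L}" "g 0 = x" "g L = y"
    "\<And>s. s \<in> {0..L} \<Longrightarrow> g s \<in> E"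
    "\<And>s t. \<lbrakk>s \<in> {0..L}; t \<in> {0..L}\<rbrakk> \<Longrightarrow> d (g s) (g t) = \<bar>s - t\<bar>"
    using geodesic_segmentE[OF S] by blast
  \<comment> \<open>Half of the gap between \<open>\<delta>\<close> and \<open>\<delta>'\<close> pays for the step from one side to the other.\<close>
  define \<eta> where "\<eta> = (\<delta>' - \<delta>) / 2"
  have \<eta>: "0 < \<eta>" "\<delta> < \<delta>' - \<eta>" using \<open>\<delta> < \<delta>'\<close> by (simp_all add: \<eta>_def field_simps)
  define P where "P t \<longleftrightarrow> (\<exists>q\<in>S3. d (g t) q < \<delta>' - \<eta>)" for t
  have "0 < \<delta>' - \<eta>" using \<eta> H by (auto simp: hyperbolic_space_def)
  then have P0: "P 0"
    unfolding P_def using geodesic_segment_endpoints[OF S3] g(3) by force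
  have other: "\<exists>q\<in>S2. d (g t) q < \<delta>' - \<eta>" if "t \<in> {0..L}" "\<not> P t" for t
    using hyperbolic_space_near_other_sides[OF H \<eta>(2) S S2 S3, of "g t"] that g(2)
    unfolding P_def by blast
  have "\<exists>s t. s \<in> {0..L} \<and> t \<in> {0..L} \<and> \<bar>t - s\<bar> \<le> \<eta> \<and> P s \<and> (\<exists>q\<in>S2. d (g t) q < \<delta>' - \<eta>)"
  proof (cases "P L")
    case True
    have "\<exists>q\<in>S2. d (g L) q < \<delta>' - \<eta>"
      using geodesic_segment_endpoints[OF S2] g(4) \<open>0 < \<delta>' - \<eta>\<close> by force
    then show ?thesis using True g(1) \<eta>(1) by (intro exI[of _ L]) auto
  next
    case False
    obtain s t where "0 \<le> s" "s \<le> t" "t \<le> L" "t - s \<le> \<eta>" "P s" "\<not> P t"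
      using last_exit[of 0 L P \<eta>] g(1) P0 False \<eta>(1) by (metis order_refl)
    then show ?thesis using other[of t] by (intro exI[of _ s] exI[of _ t]) auto
  qed
  then obtain s t q q' where st: "s \<in> {0..L}" "t \<in> {0..L}" "\<bar>t - s\<bar> \<le> \<eta>"
    and q: "q \<in> S3" "d (g s) q < \<delta>' - \<eta>" and q': "q' \<in> S2" "d (g t) q' < \<delta>' - \<eta>"
    unfolding P_def by blast
  let ?p = "g s"
  have M: "?p \<in> E" "g t \<in> E" "q \<in> E" "q' \<in> E"
    using g(5) st geodesic_segment_dist_add(2)[OF S3 q(1)] geodesic_segment_dist_add(2)[OF S2 q'(1)]
    by auto
  have "?p \<in> S" using st g(2) by blast
  have 1: "d w q + d q x = d w x" "d y q' + d q' w = d y w" "d x ?p + d ?p y = d x y"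
    using geodesic_segment_dist_add(1)[OF S3 q(1)] geodesic_segment_dist_add(1)[OF S2 q'(1)]
      geodesic_segment_dist_add(1)[OF S \<open>?p \<in> S\<close>] by auto
  have 2: "d ?p q' < \<delta>'"
    using triangle[of ?p "g t" q'] M g(6)[of s t] st q'(2) by auto
  have "2 * d w ?p \<le> d w x + d w y - d x y + 4 * \<delta>'"
    using 1 2 q(2) \<eta>(1) triangle[of w q ?p] triangle[of w q' ?p] triangle[of x q ?p] triangle[of y q' ?p]
      M xy \<open>w \<in> E\<close> by (simp add: commute)
  then show ?thesis
    using that[OF \<open>?p \<in> S\<close>] by (simp add: gromov_product_def field_simps)
qed

text \<open>
  The point of the segment from \<open>x\<close> to \<open>z\<close> that is nearly closest to \<open>w\<close> lies near one of the
  other two sides, and the distance from \<open>w\<close> to such a side bounds its Gromov product from above.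
\<close>

lemma hyperbolic_four_point:
  assumes H: "hyperbolic_space \<delta> E d" and "\<delta> < \<delta>'"
    and E: "w \<in> E" "x \<in> E" "y \<in> E" "z \<in> E"
  shows "min (Metric_space.gromov_product d x y w) (Metric_space.gromov_product d y z w)
           \<le> Metric_space.gromov_product d x z w + 3 * \<delta>'"
proof -
  interpret Metric_space E d
    using H by (simp add: hyperbolic_space_def geodesic_metric_space_def)
  obtain S1 S2 S3 where S: "geodesic_segment E d x z S1" "geodesic_segment E d z y S2"
      "geodesic_segment E d y x S3"
    using hyperbolic_space_segment[OF H] E by metis
  obtain p where p: "p \<in> S1" "d w p \<le> gromov_product x z w + 2 * \<delta>'"
    using dist_segment_le_gromov_product[OF H \<open>\<delta> < \<delta>'\<close> S(1) E(1)] by blast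
  obtain q where q: "q \<in> S2 \<union> S3" "d p q < \<delta>'"
    using hyperbolic_space_near_other_sides[OF H \<open>\<delta> < \<delta>'\<close> S p(1)] by blast
  have "p \<in> E" "q \<in> E"
    using geodesic_segment_dist_add(2) S p(1) q(1) by blast+
  then have "d w q \<le> gromov_product x z w + 3 * \<delta>'"
    using p(2) q(2) triangle[of w p q] E by simp
  moreover have "gromov_product z y w \<le> d w q \<or> gromov_product y x w \<le> d w q"
    using q(1) gromov_product_le_dist_segment S E by blast
  ultimately show ?thesis
    by (auto simp: gromov_product_commute min_def)
qed

section \<open>A discrete blow-up\<close>

text \<open>
  This is the Euler scheme with step 1 for \<open>x' = a * 2 powr x\<close>, whose solution explodes at a time
  proportional to \<open>1 / a\<close>. The scheme itself never becomes infinite, but from about that time on it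
  grows faster than any given linear function.
\<close>

primrec blowup :: "real \<Rightarrow> nat \<Rightarrow> real" where
  "blowup a 0 = 0"
| "blowup a (Suc k) = blowup a k + a * 2 powr blowup a k"

lemma two_powr_ge:
  fixes t :: real
  assumes "0 \<le> t"
  shows "1 + t / 2 \<le> 2 powr t"
proof -
  have "1 + t / 2 \<le> 1 + t * ln 2"
    using ln2_ge_two_thirds mult_left_mono[OF _ assms, of "1/2" "ln 2"] by simp
  also have "\<dots> \<le> exp (t * ln 2)" by (rule exp_ge_add_one_self)
  finally show ?thesis by (simp add: powr_def)
qed

lemma blowup_mono:
  assumes "0 \<le> a" "i \<le> j"
  shows "blowup a i \<le> blowup a j"
  using lift_Suc_mono_le[of "blowup a" i j] assms by simp

text \<open>
  As for the differential equation, \<open>2 powr (- x)\<close> decreases at a rate proportional to \<open>a\<close>. This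
  holds as long as the increments stay bounded, here by 8; the number \<open>1 / 10\<close> is what the
  bound 8 leaves of the rate.
\<close>

lemma blowup_reciprocal:
  assumes "0 < a" "\<And>i. i < j \<Longrightarrow> a * 2 powr blowup a i < 8"
  shows "2 powr (- blowup a j) \<le> 1 - real j * (a / 10)"
  using assms(2)
proof (induction j)
  case 0
  then show ?case by simp
next
  case (Suc j)
  define x where "x = blowup a j"
  define t where "t = a * 2 powr x"
  have t: "0 \<le> t" "t < 8" using Suc.prems[of j] assms(1) by (simp_all add: t_def x_def)
  have "1 * 1 \<le> (1 + t / 2) * (1 - t / 10)"
    using mult_nonneg_nonneg[of t "8 - t"] t by (simp add: algebra_simps)
  also have "\<dots> \<le> 2 powr t * (1 - t / 10)"
    using t two_powr_ge[of t] by (intro mult_right_mono) auto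
  finally have "2 powr (- t) \<le> 1 - t / 10"
    by (simp add: powr_minus field_simps)
  then have "2 powr (- x) * 2 powr (- t) \<le> 2 powr (- x) * (1 - t / 10)"
    by (intro mult_left_mono) auto
  also have "\<dots> = 2 powr (- x) - a / 10"
    by (simp add: t_def powr_minus field_simps)
  finally have "2 powr (- (x + t)) \<le> 2 powr (- x) - a / 10"
    by (simp add: powr_add[symmetric])
  moreover have "2 powr (- x) \<le> 1 - real j * (a / 10)"
    using Suc by (simp add: x_def)
  moreover have "real (Suc j) * (a / 10) = real j * (a / 10) + a / 10"
    by (simp add: field_simps)
  ultimately show ?case unfolding blowup.simps x_def t_def by linarith
qed

text \<open>
  Since \<open>2 powr (- x)\<close> stays positive, an increment of at least 8 occurs before time \<open>10 / a\<close>. The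
  increments never decrease, so the slope is at least 8 afterwards, twice the slope 4 of the given
  linear function.
\<close>

lemma blowup_outgrows_linear:
  assumes "0 < a" "blowup a k \<le> 4 * real k + 14"
  shows "real k \<le> 20 / a + 4"
proof -
  define c where "c = 10 / a"
  have c: "0 < c" "20 / a = 2 * c" using assms(1) by (simp_all add: c_def)
  define j where "j = nat \<lceil>c\<rceil>"
  have j: "c \<le> real j" "real j < c + 1"
    using c(1) unfolding j_def by (simp_all add: of_nat_nat) linarith
  have "\<exists>i<j. 8 \<le> a * 2 powr blowup a i"
  proof (rule ccontr)
    assume "\<not> ?thesis"
    then have "2 powr (- blowup a j) \<le> 1 - real j * (a / 10)"
      by (intro blowup_reciprocal assms(1)) force
    moreover have "1 \<le> real j * (a / 10)"
      using j(1) assms(1) by (simp add: c_def field_simps)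
    ultimately show False using powr_gt_zero[of 2 "- blowup a j"] by linarith
  qed
  then obtain i where i: "i < j" "8 \<le> a * 2 powr blowup a i" by blast
  have lin: "8 * real n \<le> blowup a (i + n)" for n
  proof (induction n)
    case 0
    show ?case using blowup_mono[of a 0 i] assms(1) by simp
  next
    case (Suc n)
    have "a * 2 powr blowup a i \<le> a * 2 powr blowup a (i + n)"
      using blowup_mono[of a i "i + n"] assms(1) by (intro mult_left_mono) auto
    with Suc i(2) show ?case by simp
  qed
  show ?thesis
  proof (cases "i \<le> k")
    case True
    then have "8 * (real k - real i) \<le> 4 * real k + 14"
      using lin[of "k - i"] assms(2) by (simp add: of_nat_diff)
    then have "2 * real k \<le> 4 * real i + 7" by (simp add: algebra_simps)
    moreover have "real i \<le> c" using i(1) j(2) by linarith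
    ultimately show ?thesis unfolding c(2) by linarith
  next
    case False
    then show ?thesis unfolding c(2) using c(1) i(1) j(2) by linarith
  qed
qed

section \<open>Coarse paths in a Gromov hyperbolic space\<close>

text \<open>
  One scale \<open>e\<close> serves both as the hyperbolicity constant and as the additive error of the paths
  below. It is positive, so that \<open>e / \<Lambda>\<close> is a usable unit of time: within it, a path moves by at
  most \<open>2 * e\<close>.
\<close>

locale gromov_hyperbolic = Metric_space +
  fixes e :: real
  assumes e_pos: "0 < e"
    and four_point: "\<lbrakk>w \<in> M; x \<in> M; y \<in> M; z \<in> M\<rbrakk> \<Longrightarrow>
      min (gromov_product x y w) (gromov_product y z w) \<le> gromov_product x z w + e"
begin

definition coarse_path :: "real \<Rightarrow> real \<Rightarrow> (real \<Rightarrow> 'a) \<Rightarrow> bool" where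
  "coarse_path \<Lambda> L g \<longleftrightarrow> 1 \<le> \<Lambda> \<and> 0 \<le> L \<and> g \<in> {0..L} \<rightarrow> M \<and>
     (\<forall>s\<in>{0..L}. \<forall>t\<in>{0..L}. d (g s) (g t) \<le> \<Lambda> * \<bar>s - t\<bar> + e)"

lemma coarse_path_in: "\<lbrakk>coarse_path \<Lambda> L g; 0 \<le> t; t \<le> L\<rbrakk> \<Longrightarrow> g t \<in> M"
  by (auto simp: coarse_path_def)

lemma coarse_path_dist:
  "\<lbrakk>coarse_path \<Lambda> L g; 0 \<le> s; s \<le> L; 0 \<le> t; t \<le> L\<rbrakk> \<Longrightarrow> d (g s) (g t) \<le> \<Lambda> * \<bar>s - t\<bar> + e"
  by (auto simp: coarse_path_def)

lemma coarse_path_short: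
  assumes "coarse_path \<Lambda> L g" "0 \<le> s" "s \<le> t" "t \<le> L" "t - s \<le> e / \<Lambda>"
  shows "d (g s) (g t) \<le> 2 * e"
proof -
  have "1 \<le> \<Lambda>" using assms(1) by (simp add: coarse_path_def)
  then have "\<Lambda> * (t - s) \<le> e" using assms(5) by (simp add: field_simps)
  then show ?thesis using coarse_path_dist[OF assms(1), of s t] assms(2-4) by simp
qed

text \<open>
  A path that stays at distance \<open>B\<close> from \<open>w\<close> keeps its direction as seen from \<open>w\<close> for a
  time exponential in \<open>B\<close>. Each halving of the time interval costs one application of the four-point
  inequality, hence one \<open>e\<close>, and after \<open>k\<close> halvings the two ends of each piece are so close to each
  other that their product at \<open>w\<close> is almost their distance to \<open>w\<close>.
\<close>

lemma exponential_contraction: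
  assumes path: "coarse_path \<Lambda> L g" and w: "w \<in> M"
    and "0 \<le> p" "p \<le> q" "q \<le> L" "q - p \<le> 2 ^ k * (e / \<Lambda>)"
    and "\<And>t. \<lbrakk>p \<le> t; t \<le> q\<rbrakk> \<Longrightarrow> B \<le> d w (g t)"
  shows "B - 2 * e - real k * e \<le> gromov_product (g p) (g q) w"
  using assms(3-)
proof (induction k arbitrary: p q)
  case 0
  have "g p \<in> M" "g q \<in> M" using coarse_path_in[OF path] 0 by auto
  moreover have "d (g p) (g q) \<le> 2 * e" using coarse_path_short[OF path] 0 by auto
  ultimately show ?case
    using gromov_product_ge_dist_minus[of "g p" "g q" w] w "0.prems"(2) "0.prems"(5)[of p] by simp
next
  case (Suc k)
  define m where "m = (p + q) / 2"
  have m: "p \<le> m" "m \<le> q" "q - m \<le> 2 ^ k * (e / \<Lambda>)" "m - p \<le> 2 ^ k * (e / \<Lambda>)"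
    using Suc.prems(2,4) by (simp_all add: m_def field_simps)
  have "B - 2 * e - real k * e \<le> gromov_product (g p) (g m) w"
    using Suc.IH[of p m] Suc.prems m by simp
  moreover have "B - 2 * e - real k * e \<le> gromov_product (g m) (g q) w"
    using Suc.IH[of m q] Suc.prems m by simp
  moreover have "g p \<in> M" "g m \<in> M" "g q \<in> M"
    using coarse_path_in[OF path] Suc.prems m by auto
  ultimately show ?case
    using four_point[of w "g p" "g m" "g q"] w by (simp add: algebra_simps)
qed

text \<open>
  Call the product of \<open>g t\<close> and \<open>y\<close> at \<open>w\<close> the depth of \<open>g t\<close>; in a tree it is the length of the
  common initial part of the segments from \<open>w\<close> to \<open>g t\<close> and to \<open>y\<close>. Going back in time from \<open>r\<close>, the
  time \<open>r1\<close> is where the depth has just fallen to about \<open>s\<close>. It changes by at most \<open>2 * e\<close> per unit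
  \<open>e / \<Lambda>\<close> of time, whence the slack of \<open>2 * e\<close>.
\<close>

lemma crossing:
  assumes path: "coarse_path \<Lambda> L g" and "w \<in> M" "y \<in> M" "0 \<le> r" "r \<le> L"
    and deep: "s + 2 * e \<le> gromov_product (g r) y w"
    and shallow: "gromov_product (g 0) y w < s + 2 * e"
  obtains r1 where "0 \<le> r1" "r1 \<le> r" "gromov_product (g r1) y w < s + 2 * e"
    "\<And>t. \<lbrakk>r1 \<le> t; t \<le> r\<rbrakk> \<Longrightarrow> s \<le> gromov_product (g t) y w"
proof -
  have "0 < e / \<Lambda>" using path e_pos by (simp add: coarse_path_def)
  then obtain r1 r2 where r: "0 \<le> r1" "r1 \<le> r2" "r2 \<le> r" "r2 - r1 \<le> e / \<Lambda>"
      "gromov_product (g r1) y w < s + 2 * e"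
      and after: "\<And>u. r2 \<le> u \<Longrightarrow> u \<le> r \<Longrightarrow> \<not> gromov_product (g u) y w < s + 2 * e"
    using last_exit[of 0 r "\<lambda>t. gromov_product (g t) y w < s + 2 * e" "e / \<Lambda>"]
      \<open>0 \<le> r\<close> deep shallow by (metis not_less)
  show ?thesis
  proof (rule that[of r1])
    fix t assume t: "r1 \<le> t" "t \<le> r"
    show "s \<le> gromov_product (g t) y w"
    proof (cases "r2 \<le> t")
      case True
      then show ?thesis using after[of t] t e_pos by simp
    next
      case False
      have "d (g t) (g r2) \<le> 2 * e"
        using coarse_path_short[OF path, of t r2] False r t \<open>r \<le> L\<close> by simp
      moreover have "g t \<in> M" "g r2 \<in> M"
        using coarse_path_in[OF path] False r t \<open>r \<le> L\<close> by auto
      ultimately show ?thesis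
        using gromov_product_lipschitz[of "g r2" "g t" y w] after[of r2] r \<open>w \<in> M\<close> \<open>y \<in> M\<close>
        by (simp add: commute)
    qed
  qed (use r in auto)
qed

text \<open>
  If \<open>r - r1\<close> were smaller, then by contraction \<open>g r\<close> and \<open>g r1\<close> would have a product of at least
  \<open>s + 4 * e\<close>, and the four-point inequality would raise the depth of \<open>g r1\<close> to \<open>s + 3 * e\<close>.
\<close>

lemma crossing_time:
  assumes path: "coarse_path \<Lambda> L g" and wy: "w \<in> M" "y \<in> M" and r: "0 \<le> r1" "r1 \<le> r" "r \<le> L"
    and deep: "s + 4 * e \<le> gromov_product (g r) y w"
    and shallow: "gromov_product (g r1) y w < s + 2 * e"
    and far: "\<And>t. \<lbrakk>r1 \<le> t; t \<le> r\<rbrakk> \<Longrightarrow> B \<le> d w (g t)"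
  shows "e / \<Lambda> * 2 powr ((B - s) / e - 7) \<le> r - r1"
proof -
  have \<Lambda>: "1 \<le> \<Lambda>" using path by (simp add: coarse_path_def)
  have M: "g r \<in> M" "g r1 \<in> M" using coarse_path_in[OF path] r by auto
  define X where "X = (B - s) / e - 6"
  have B: "B = s + 6 * e + X * e" using e_pos by (simp add: X_def field_simps)
  have "e / \<Lambda> * 2 powr (X - 1) \<le> r - r1"
  proof (cases "X < 0")
    case True
    \<comment> \<open>Contraction says nothing here, but a change of depth by \<open>2 * e\<close> already takes a unit of time.\<close>
    have "s + 4 * e < s + 2 * e + d (g r) (g r1)"
      using gromov_product_lipschitz[of "g r" "g r1" y w] M wy deep shallow by linarith
    also have "d (g r) (g r1) \<le> \<Lambda> * (r - r1) + e"
      using coarse_path_dist[OF path, of r r1] r by simp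
    finally have "e / \<Lambda> \<le> r - r1" using \<Lambda> by (simp add: field_simps)
    moreover have "e / \<Lambda> * 2 powr (X - 1) \<le> e / \<Lambda> * 2 powr 0"
      using True e_pos \<Lambda> by (intro mult_left_mono powr_mono) auto
    ultimately show ?thesis by simp
  next
    case False
    define k where "k = nat \<lfloor>X\<rfloor>"
    have k: "real k \<le> X" "X - 1 \<le> real k" using False by (simp_all add: k_def)
    have "\<not> r - r1 \<le> 2 ^ k * (e / \<Lambda>)"
    proof
      assume "r - r1 \<le> 2 ^ k * (e / \<Lambda>)"
      then have "B - 2 * e - real k * e \<le> gromov_product (g r1) (g r) w"
        using exponential_contraction[OF path wy(1) r] far by blast
      moreover have "real k * e \<le> X * e" using k(1) e_pos by simp
      ultimately have "s + 4 * e \<le> gromov_product (g r1) (g r) w"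
        using B by linarith
      then show False
        using four_point[of w "g r1" "g r" y] M wy deep shallow e_pos by (simp add: min_def split: if_splits)
    qed
    moreover have "e / \<Lambda> * 2 powr (X - 1) \<le> e / \<Lambda> * 2 powr real k"
      using k(2) e_pos \<Lambda> by (intro mult_left_mono) auto
    ultimately show ?thesis by (simp add: powr_realpow mult.commute)
  qed
  moreover have "X - 1 = (B - s) / e - 7" by (simp add: X_def)
  ultimately show ?thesis by simp
qed

end

section \<open>Two branches issuing from a point\<close>

text \<open>
  The two halves of a quasi-geodesic, seen from an intermediate point \<open>w\<close> and parametrised by the
  time elapsed since \<open>w\<close>. The hypothesis \<open>separated\<close> is the lower quasi-geodesic inequality between
  the halves, which keeps them apart.
\<close>

locale two_branches = gromov_hyperbolic +
  fixes \<Lambda> :: real and w :: 'a and g h :: "real \<Rightarrow> 'a" and Lg Lh :: real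
  assumes g: "coarse_path \<Lambda> Lg g" "g 0 = w" and h: "coarse_path \<Lambda> Lh h" "h 0 = w"
    and separated: "\<lbrakk>0 \<le> r; r \<le> Lg; 0 \<le> r'; r' \<le> Lh\<rbrakk> \<Longrightarrow> (r + r') / \<Lambda> - e \<le> d (g r) (h r')"
begin

definition branch_product :: real where "branch_product = gromov_product (g Lg) (h Lh) w"

text \<open>
  The depth of a point is measured towards the end of its own branch. By the four-point inequality
  this agrees, up to \<open>e\<close> and as long as it is below \<open>branch_product\<close>, with the depth towards the
  end of the other branch.
\<close>

definition deep_g :: "real \<Rightarrow> real \<Rightarrow> bool" where
  "deep_g s r \<longleftrightarrow> 0 \<le> r \<and> r \<le> Lg \<and> s \<le> gromov_product (g r) (g Lg) w"

definition deep_h :: "real \<Rightarrow> real \<Rightarrow> bool" where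
  "deep_h s r \<longleftrightarrow> 0 \<le> r \<and> r \<le> Lh \<and> s \<le> gromov_product (h r) (h Lh) w"

lemma lambda_ge_1: "1 \<le> \<Lambda>"
  using g(1) by (simp add: coarse_path_def)

lemma ends_in: "w \<in> M" "g Lg \<in> M" "h Lh \<in> M" "0 \<le> Lg" "0 \<le> Lh"
  using g h coarse_path_in[OF g(1), of 0] coarse_path_in[OF g(1), of Lg] coarse_path_in[OF h(1), of Lh]
  by (auto simp: coarse_path_def)

text \<open>
  Below depth \<open>branch_product\<close> the two branches shadow the same segment issuing from \<open>w\<close>: two points of
  depth at least \<open>s\<close> can be joined without going back to \<open>w\<close>, which saves the first \<open>s\<close> of both.
\<close>

lemma dist_branches_le:
  assumes "s \<le> branch_product" "deep_g s r" "deep_h s r'"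
  shows "d (g r) (h r') \<le> d w (g r) + d w (h r') - 2 * s + 4 * e"
proof -
  have M: "g r \<in> M" "h r' \<in> M"
    using coarse_path_in g(1) h(1) assms by (auto simp: deep_g_def deep_h_def)
  have "s - e \<le> gromov_product (g r) (h Lh) w"
    using four_point[of w "g r" "g Lg" "h Lh"] M ends_in assms
    by (simp add: branch_product_def deep_g_def min_def split: if_splits)
  moreover have "s \<le> gromov_product (h Lh) (h r') w"
    using assms by (simp add: deep_h_def gromov_product_commute)
  ultimately have "s - 2 * e \<le> gromov_product (g r) (h r') w"
    using four_point[of w "g r" "h Lh" "h r'"] M ends_in e_pos by (simp add: min_def split: if_splits)
  then show ?thesis by (simp add: gromov_product_def field_simps)
qed

text \<open>
  If all pairs of points of depth \<open>s\<close> are far apart in time, then they are far apart in space, so at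
  one of them the branch is far from \<open>w\<close>. Going by pairs, one of the two branches is far from \<open>w\<close>
  during its whole passage from depth \<open>s + 4 * e\<close> to depth \<open>s\<close>, and by contraction this passage
  takes a time exponential in the separation. The number 2048 is \<open>2 ^ 11\<close>: up to
  rounding, \<open>19 / 2\<close> of the exponent collects the additive errors, and the rest is the factor 2
  in \<open>2 * \<Lambda> * e\<close>. One factor \<open>\<Lambda>\<close> comes from converting time into
  distance, the other one from the length \<open>e / \<Lambda>\<close> of the unit of time.
\<close>

lemma depth_step:
  assumes s: "0 \<le> s" "s \<le> branch_product"
    and X: "\<And>r r'. \<lbrakk>deep_g s r; deep_h s r'\<rbrakk> \<Longrightarrow> 2 * \<Lambda> * e * X \<le> r + r'"
    and r: "deep_g (s + 4 * e) r" "deep_h (s + 4 * e) r'"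
  shows "2 * \<Lambda> * e * (X + 1 / (2048 * \<Lambda>\<^sup>2) * 2 powr X) \<le> r + r'"
proof -
  have rg: "0 \<le> r" "r \<le> Lg" "s + 4 * e \<le> gromov_product (g r) (g Lg) w"
    and rh: "0 \<le> r'" "r' \<le> Lh" "s + 4 * e \<le> gromov_product (h r') (h Lh) w"
    using r by (auto simp: deep_g_def deep_h_def)
  obtain r1 where r1: "0 \<le> r1" "r1 \<le> r" "gromov_product (g r1) (g Lg) w < s + 2 * e"
      "\<And>t. \<lbrakk>r1 \<le> t; t \<le> r\<rbrakk> \<Longrightarrow> s \<le> gromov_product (g t) (g Lg) w"
    by (rule crossing[OF g(1) ends_in(1,2) rg(1,2), of s]) (use rg(3) e_pos s(1) g(2) ends_in in auto)
  obtain r2 where r2: "0 \<le> r2" "r2 \<le> r'" "gromov_product (h r2) (h Lh) w < s + 2 * e"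
      "\<And>t. \<lbrakk>r2 \<le> t; t \<le> r'\<rbrakk> \<Longrightarrow> s \<le> gromov_product (h t) (h Lh) w"
    by (rule crossing[OF h(1) ends_in(1,3) rh(1,2), of s]) (use rh(3) e_pos s(1) h(2) ends_in in auto)
  have dg: "deep_g s t" if "r1 \<le> t" "t \<le> r" for t
    using that r1 rg by (auto simp: deep_g_def)
  have dh: "deep_h s t" if "r2 \<le> t" "t \<le> r'" for t
    using that r2 rh by (auto simp: deep_h_def)
  \<comment> \<open>A point of depth \<open>s\<close> on each branch: the sum of their distances to \<open>w\<close> is at least \<open>2 * B\<close>.\<close>
  define B where "B = X * e + s - 5 / 2 * e"
  have exponent: "(B - s) / e - 7 = X - 19 / 2"
    using e_pos by (simp add: B_def field_simps)
  have "e / \<Lambda> * 2 powr (X - 19 / 2) \<le> (r - r1) + (r' - r2)"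
  proof (cases "\<forall>t. r1 \<le> t \<longrightarrow> t \<le> r \<longrightarrow> B \<le> d w (g t)")
    case True
    then have "e / \<Lambda> * 2 powr (X - 19 / 2) \<le> r - r1"
      using crossing_time[OF g(1) ends_in(1,2) r1(1,2) rg(2,3) r1(3), of B] exponent by simp
    then show ?thesis using r2(2) by simp
  next
    case False
    then obtain t where t: "r1 \<le> t" "t \<le> r" "d w (g t) < B" by force
    have "B \<le> d w (h t')" if t': "r2 \<le> t'" "t' \<le> r'" for t'
    proof -
      have "2 * \<Lambda> * e * X \<le> t + t'" using X dg dh t t' by blast
      then have "2 * e * X \<le> (t + t') / \<Lambda>"
        using lambda_ge_1 by (simp add: field_simps)
      also have "\<dots> \<le> d (g t) (h t') + e"
        using separated[of t t'] t t' r1(1) r2(1) rg(2) rh(2) by simp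
      also have "\<dots> \<le> d w (g t) + d w (h t') - 2 * s + 5 * e"
        using dist_branches_le[OF s(2) dg[OF t(1,2)] dh[OF t']] by simp
      finally show ?thesis using t(3) by (simp add: B_def algebra_simps)
    qed
    then have "e / \<Lambda> * 2 powr (X - 19 / 2) \<le> r' - r2"
      using crossing_time[OF h(1) ends_in(1,3) r2(1,2) rh(2,3) r2(3), of B] exponent by simp
    then show ?thesis using r1(2) by simp
  qed
  moreover have "e / \<Lambda> * 2 powr (X - 10) \<le> e / \<Lambda> * 2 powr (X - 19 / 2)"
    using e_pos lambda_ge_1 by (intro mult_left_mono) auto
  moreover have "e / \<Lambda> * 2 powr (X - 10) = 2 * \<Lambda> * e * (1 / (2048 * \<Lambda>\<^sup>2) * 2 powr X)"
    using lambda_ge_1 by (simp add: powr_diff power2_eq_square field_simps)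
  moreover have "2 * \<Lambda> * e * X \<le> r1 + r2"
    using X dg[of r1] dh[of r2] r1(2) r2(2) by blast
  ultimately show ?thesis by (simp add: distrib_left)
qed

lemma depth_time:
  assumes "real k * (4 * e) \<le> branch_product" "deep_g (real k * (4 * e)) r" "deep_h (real k * (4 * e)) r'"
  shows "2 * \<Lambda> * e * blowup (1 / (2048 * \<Lambda>\<^sup>2)) k \<le> r + r'"
  using assms
proof (induction k arbitrary: r r')
  case 0
  then show ?case by (simp add: deep_g_def deep_h_def)
next
  case (Suc k)
  have "real k * (4 * e) + 4 * e = real (Suc k) * (4 * e)" by (simp add: algebra_simps)
  then show ?case
    using depth_step[of "real k * (4 * e)" "blowup (1 / (2048 * \<Lambda>\<^sup>2)) k" r r'] Suc e_pos by simp
qed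

text \<open>
  The hypotheses \<open>near_g\<close> and \<open>near_h\<close> say that the product of the two ends of a branch, at any
  point of it, exceeds \<open>branch_product\<close> by at most \<open>e\<close>. They limit the time at
  which a branch reaches a depth close to \<open>branch_product\<close>: its position there is within about
  \<open>2 * branch_product\<close> of \<open>w\<close>. This bound is linear in the number \<open>k\<close> of steps of length \<open>4 * e\<close>
  contained in \<open>branch_product\<close>, whereas the time needed for \<open>k\<close> steps follows the explosive
  recursion. Hence \<open>k\<close> is at most a multiple of the explosion time, which is of order \<open>\<Lambda>\<^sup>2\<close>.
\<close>

lemma branch_product_le:
  assumes near_g: "\<And>r. \<lbrakk>0 \<le> r; r \<le> Lg\<rbrakk> \<Longrightarrow> gromov_product w (g Lg) (g r) \<le> branch_product + e"
    and near_h: "\<And>r. \<lbrakk>0 \<le> r; r \<le> Lh\<rbrakk> \<Longrightarrow> gromov_product w (h Lh) (h r) \<le> branch_product + e"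
  shows "branch_product \<le> 163864 * \<Lambda>\<^sup>2 * e"
proof (cases "branch_product < 4 * e")
  case True
  have "4 * e \<le> 163864 * \<Lambda>\<^sup>2 * e"
    using lambda_ge_1 e_pos one_le_power[of \<Lambda> 2] by (intro mult_right_mono) linarith+
  then show ?thesis using True by linarith
next
  case False
  \<comment> \<open>One step is left out, so that the ends of both branches lie a step beyond depth \<open>s\<close>.\<close>
  define k where "k = nat \<lfloor>branch_product / (4 * e) - 1\<rfloor>"
  have "1 \<le> branch_product / (4 * e)" using False e_pos by simp
  then have "real k \<le> branch_product / (4 * e) - 1" "branch_product / (4 * e) < real k + 2"
    by (simp_all add: k_def) linarith
  then have k: "real k * (4 * e) + 4 * e \<le> branch_product" "branch_product < (real k + 2) * (4 * e)"
    using e_pos by (simp_all add: field_simps)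
  define s where "s = real k * (4 * e)"
  have s: "0 \<le> s" "s + 4 * e \<le> branch_product" using k(1) e_pos by (simp_all add: s_def)
  have "branch_product \<le> d w (g Lg)" "branch_product \<le> d w (h Lh)"
    using gromov_product_le_dist[of "g Lg" "h Lh" w] gromov_product_le_dist[of "h Lh" "g Lg" w] ends_in
    by (simp_all add: branch_product_def gromov_product_commute)
  then have deep: "s + 2 * e \<le> gromov_product (g Lg) (g Lg) w" "s + 2 * e \<le> gromov_product (h Lh) (h Lh) w"
    using s e_pos ends_in by auto
  have shallow: "gromov_product (g 0) (g Lg) w < s + 2 * e" "gromov_product (h 0) (h Lh) w < s + 2 * e"
    using g(2) h(2) ends_in s e_pos by auto
  obtain r where r: "0 \<le> r" "r \<le> Lg" "gromov_product (g r) (g Lg) w < s + 2 * e"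
      "\<And>t. \<lbrakk>r \<le> t; t \<le> Lg\<rbrakk> \<Longrightarrow> s \<le> gromov_product (g t) (g Lg) w"
    using crossing[OF g(1) ends_in(1,2,4) order_refl deep(1) shallow(1)] by blast
  obtain r' where r': "0 \<le> r'" "r' \<le> Lh" "gromov_product (h r') (h Lh) w < s + 2 * e"
      "\<And>t. \<lbrakk>r' \<le> t; t \<le> Lh\<rbrakk> \<Longrightarrow> s \<le> gromov_product (h t) (h Lh) w"
    using crossing[OF h(1) ends_in(1,3,5) order_refl deep(2) shallow(2)] by blast
  have dd: "deep_g s r" "deep_h s r'" using r r' by (auto simp: deep_g_def deep_h_def)
  have "(r + r') / \<Lambda> \<le> d (g r) (h r') + e" using separated[of r r'] r r' by simp
  also have "\<dots> \<le> d w (g r) + d w (h r') - 2 * s + 5 * e"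
    using dist_branches_le[OF _ dd] s e_pos by simp
  also have "\<dots> \<le> 2 * branch_product + 11 * e"
    using dist_eq_gromov_products[of w "g r" "g Lg"] dist_eq_gromov_products[of w "h r'" "h Lh"]
      r r' near_g[of r] near_h[of r'] by simp
  finally have "(r + r') / \<Lambda> \<le> 2 * branch_product + 11 * e" .
  moreover have "2 * e * blowup (1 / (2048 * \<Lambda>\<^sup>2)) k \<le> (r + r') / \<Lambda>"
    using depth_time[of k r r'] dd s e_pos lambda_ge_1 by (simp add: s_def field_simps)
  ultimately have "2 * e * blowup (1 / (2048 * \<Lambda>\<^sup>2)) k \<le> 2 * e * (4 * real k + 14)"
    using k(2) e_pos by (simp add: algebra_simps)
  then have "blowup (1 / (2048 * \<Lambda>\<^sup>2)) k \<le> 4 * real k + 14" using e_pos by simp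
  then have "real k \<le> 20 / (1 / (2048 * \<Lambda>\<^sup>2)) + 4"
    using lambda_ge_1 by (intro blowup_outgrows_linear) auto
  then have "(real k + 2) * 4 \<le> 163864 * \<Lambda>\<^sup>2"
    using one_le_power[OF lambda_ge_1, of 2] by simp
  then have "(real k + 2) * 4 * e \<le> 163864 * \<Lambda>\<^sup>2 * e"
    using e_pos by (intro mult_right_mono) auto
  then show ?thesis using k(2) by (simp add: algebra_simps)
qed

end

section \<open>Quasi-geodesics stay close to geodesics\<close>

text \<open>
  A triple of times that nearly maximises the product provides branches to which the previous
  bound applies, because every sub-branch gives a competing triple. A supremum need not be attained,
  since \<open>\<gamma>\<close> may be discontinuous; an approximation up to \<open>e\<close> is enough.
\<close>

lemma quasi_geodesic_gromov_product_le:
  assumes H: "hyperbolic_space \<delta> E d" and "\<delta> < \<delta>'"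
    and Q: "quasi_geodesic \<Lambda> c E d l \<gamma>" and t: "t \<in> {0..l}"
  shows "Metric_space.gromov_product d (\<gamma> 0) (\<gamma> l) (\<gamma> t) \<le> 163865 * \<Lambda>\<^sup>2 * (3 * \<delta>' + c)"
proof -
  interpret Metric_space E d
    using H by (simp add: hyperbolic_space_def geodesic_metric_space_def)
  define e where "e = 3 * \<delta>' + c"
  have q: "1 \<le> \<Lambda>" "0 \<le> c" "0 \<le> l" "\<And>u. \<lbrakk>0 \<le> u; u \<le> l\<rbrakk> \<Longrightarrow> \<gamma> u \<in> E"
    "\<And>u v. \<lbrakk>0 \<le> u; u \<le> l; 0 \<le> v; v \<le> l\<rbrakk> \<Longrightarrow> d (\<gamma> u) (\<gamma> v) \<le> \<Lambda> * \<bar>u - v\<bar> + c"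
    "\<And>u v. \<lbrakk>0 \<le> u; u \<le> l; 0 \<le> v; v \<le> l\<rbrakk> \<Longrightarrow> \<bar>u - v\<bar> / \<Lambda> - c \<le> d (\<gamma> u) (\<gamma> v)"
    using Q unfolding quasi_geodesic_def quasi_isometry_def by auto
  have "0 \<le> \<delta>" using H by (simp add: hyperbolic_space_def)
  then have e: "0 < e" "c \<le> e" "3 * \<delta>' \<le> e"
    using \<open>\<delta> < \<delta>'\<close> q(2) by (simp_all add: e_def)
  interpret gromov_hyperbolic E d e
  proof unfold_locales
    show "min (gromov_product x y w) (gromov_product y z w) \<le> gromov_product x z w + e"
      if "w \<in> E" "x \<in> E" "y \<in> E" "z \<in> E" for w x y z
      using hyperbolic_four_point[OF H \<open>\<delta> < \<delta>'\<close> that] e(3) by linarith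
  qed (rule e(1))
  define P where
    "P = {gromov_product (\<gamma> a) (\<gamma> b) (\<gamma> z) | a z b. 0 \<le> a \<and> a \<le> z \<and> z \<le> b \<and> b \<le> l}"
  have bdd: "bdd_above P"
  proof (rule bdd_aboveI[of _ "\<Lambda> * l + c"])
    fix x assume "x \<in> P"
    then obtain a z b where x: "x = gromov_product (\<gamma> a) (\<gamma> b) (\<gamma> z)" "0 \<le> a" "a \<le> z" "z \<le> b" "b \<le> l"
      by (auto simp: P_def)
    have "x \<le> d (\<gamma> z) (\<gamma> a)" unfolding x(1) using x q(4) by (intro gromov_product_le_dist) auto
    also have "\<dots> \<le> \<Lambda> * (z - a) + c" using q(5)[of z a] x by auto
    also have "\<dots> \<le> \<Lambda> * l + c" using x q(1) by auto
    finally show "x \<le> \<Lambda> * l + c" .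
  qed
  have tP: "gromov_product (\<gamma> 0) (\<gamma> l) (\<gamma> t) \<in> P"
    using t unfolding P_def by fastforce
  have "Sup P - e < Sup P" using e(1) by simp
  then obtain x where "x \<in> P" and x: "Sup P - e < x"
    using less_cSup_iff[of P "Sup P - e"] bdd tP by blast
  then obtain a z b where x_eq: "x = gromov_product (\<gamma> a) (\<gamma> b) (\<gamma> z)"
      and abz: "0 \<le> a" "a \<le> z" "z \<le> b" "b \<le> l"
    by (auto simp: P_def)
  have max: "gromov_product (\<gamma> a') (\<gamma> b') (\<gamma> z') \<le> x + e"
    if "0 \<le> a'" "a' \<le> z'" "z' \<le> b'" "b' \<le> l" for a' z' b'
    using cSup_upper[OF _ bdd, of "gromov_product (\<gamma> a') (\<gamma> b') (\<gamma> z')"] that x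
    by (force simp: P_def)
  interpret two_branches E d e \<Lambda> "\<gamma> z" "\<lambda>r. \<gamma> (z - r)" "\<lambda>r. \<gamma> (z + r)" "z - a" "b - z"
  proof unfold_locales
    show "coarse_path \<Lambda> (z - a) (\<lambda>r. \<gamma> (z - r))"
      unfolding coarse_path_def
    proof (intro conjI ballI)
      fix r r' assume "r \<in> {0..z - a}" "r' \<in> {0..z - a}"
      then show "d (\<gamma> (z - r)) (\<gamma> (z - r')) \<le> \<Lambda> * \<bar>r - r'\<bar> + e"
        using q(5)[of "z - r" "z - r'"] abz e(2) by (simp add: abs_minus_commute)
    qed (use abz q(1,4) in auto)
    show "coarse_path \<Lambda> (b - z) (\<lambda>r. \<gamma> (z + r))"
      unfolding coarse_path_def
    proof (intro conjI ballI)
      fix r r' assume "r \<in> {0..b - z}" "r' \<in> {0..b - z}"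
      then show "d (\<gamma> (z + r)) (\<gamma> (z + r')) \<le> \<Lambda> * \<bar>r - r'\<bar> + e"
        using q(5)[of "z + r" "z + r'"] abz e(2) by simp
    qed (use abz q(1,4) in auto)
    show "(r + r') / \<Lambda> - e \<le> d (\<gamma> (z - r)) (\<gamma> (z + r'))"
      if "0 \<le> r" "r \<le> z - a" "0 \<le> r'" "r' \<le> b - z" for r r'
      using q(6)[of "z - r" "z + r'"] that abz e(2) by (simp add: add.commute)
  qed auto
  have branch_product_eq: "branch_product = x" by (simp add: branch_product_def x_eq)
  have "branch_product \<le> 163864 * \<Lambda>\<^sup>2 * e"
  proof (rule branch_product_le)
    show "gromov_product (\<gamma> z) (\<gamma> (z - (z - a))) (\<gamma> (z - r)) \<le> branch_product + e"
      if "0 \<le> r" "r \<le> z - a" for r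
      using max[of a "z - r" z] that abz by (simp add: branch_product_eq gromov_product_commute)
    show "gromov_product (\<gamma> z) (\<gamma> (z + (b - z))) (\<gamma> (z + r)) \<le> branch_product + e"
      if "0 \<le> r" "r \<le> b - z" for r
      using max[of z "z + r" b] that abz by (simp add: branch_product_eq)
  qed
  moreover have "e \<le> \<Lambda>\<^sup>2 * e"
    using mult_right_mono[OF one_le_power[OF q(1), of 2], of e] e(1) by simp
  moreover have "gromov_product (\<gamma> 0) (\<gamma> l) (\<gamma> t) \<le> x + e"
    using max[of 0 t l] t by simp
  ultimately show ?thesis
    unfolding branch_product_eq e_def[symmetric] by linarith
qed

text \<open>
  The constant \<open>\<delta>'\<close> exceeds \<open>\<delta>\<close> strictly in all bounds above. They are applied with \<open>\<delta>'\<close> tending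
  to \<open>\<delta>\<close>, which also covers the case \<open>\<delta> = c = 0\<close>, where there is no positive scale to work with.
\<close>

lemma quasi_geodesic_near_geodesic:
  "quasi_geodesics_near_geodesics 163865 491597 E d"
  unfolding quasi_geodesics_near_geodesics_def
proof (intro allI impI ballI)
  fix \<delta> \<Lambda> c l \<gamma> \<sigma> t
  assume H: "hyperbolic_space \<delta> E d" and Q: "quasi_geodesic \<Lambda> c E d l \<gamma>"
    and S: "geodesic_segment E d (\<gamma> 0) (\<gamma> l) \<sigma>" and t: "t \<in> {0..l}"
  interpret Metric_space E d
    using H by (simp add: hyperbolic_space_def geodesic_metric_space_def)
  have \<Lambda>: "1 \<le> \<Lambda>\<^sup>2" and "\<gamma> t \<in> E" and "0 \<le> \<delta>"
    using Q t H by (auto simp: quasi_geodesic_def quasi_isometry_def hyperbolic_space_def)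
  show "dist_to_set d (\<gamma> t) \<sigma> \<le> \<Lambda>\<^sup>2 * (163865 * c + 491597 * \<delta>)"
  proof (rule field_le_epsilon)
    fix \<eta> :: real assume "0 < \<eta>"
    define \<delta>' where "\<delta>' = \<delta> + \<eta> / (\<Lambda>\<^sup>2 * 491597)"
    have "\<delta> < \<delta>'" using \<open>0 < \<eta>\<close> \<Lambda> by (auto simp: \<delta>'_def intro!: divide_pos_pos)
    obtain p where p: "p \<in> \<sigma>" "d (\<gamma> t) p \<le> gromov_product (\<gamma> 0) (\<gamma> l) (\<gamma> t) + 2 * \<delta>'"
      using dist_segment_le_gromov_product[OF H \<open>\<delta> < \<delta>'\<close> S \<open>\<gamma> t \<in> E\<close>] by blast
    have "dist_to_set d (\<gamma> t) \<sigma> \<le> 163865 * \<Lambda>\<^sup>2 * (3 * \<delta>' + c) + 2 * \<delta>'"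
      using dist_to_set_le[OF p(1), of "\<gamma> t"] p(2)
        quasi_geodesic_gromov_product_le[OF H \<open>\<delta> < \<delta>'\<close> Q t] by linarith
    also have "\<dots> \<le> 163865 * \<Lambda>\<^sup>2 * (3 * \<delta>' + c) + 2 * (\<Lambda>\<^sup>2 * \<delta>')"
      using mult_right_mono[OF \<Lambda>, of \<delta>'] \<open>0 \<le> \<delta>\<close> \<open>\<delta> < \<delta>'\<close> by simp
    also have "\<dots> = \<Lambda>\<^sup>2 * (163865 * c + 491597 * \<delta>) + \<eta>"
      using \<Lambda> by (auto simp: \<delta>'_def field_simps)
    finally show "dist_to_set d (\<gamma> t) \<sigma> \<le> \<Lambda>\<^sup>2 * (163865 * c + 491597 * \<delta>) + \<eta>" .
  qed
qed

section \<open>Reduction to spaces of cardinality at most the continuum\<close>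

text \<open>
  A bound that holds for all spaces of real numbers holds for all spaces, whatever their cardinality,
  because it concerns a configuration of at most continuum many points. Such a set of points is
  contained in a geodesic subspace of at most that cardinality, and every geodesic triangle of the
  subspace is a geodesic triangle of the whole space, hence thin.
\<close>

lemma geodesic_segment_isometric_image:
  assumes S: "geodesic_segment A dA x y S" and f: "f \<in> A \<rightarrow> B"
    and iso: "\<And>u v. \<lbrakk>u \<in> A; v \<in> A\<rbrakk> \<Longrightarrow> dB (f u) (f v) = dA u v"
  shows "geodesic_segment B dB (f x) (f y) (f ` S)"
proof -
  obtain L g where "0 \<le> L" "g \<in> {0..L} \<rightarrow> A" "\<forall>s\<in>{0..L}. \<forall>t\<in>{0..L}. dA (g s) (g t) = \<bar>s - t\<bar>"
      "g 0 = x" "g L = y" "S = g ` {0..L}"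
    using S unfolding geodesic_segment_def by blast
  then show ?thesis
    unfolding geodesic_segment_def using f iso
    by (intro exI[of _ L] exI[of _ "f \<circ> g"]) (auto simp: image_image Pi_iff)
qed

lemma geodesic_segment_subset: "geodesic_segment E d x y S \<Longrightarrow> S \<subseteq> E"
  by (auto simp: geodesic_segment_def)

lemma geodesic_segment_in_subspace:
  "\<lbrakk>geodesic_segment E d x y S; S \<subseteq> F\<rbrakk> \<Longrightarrow> geodesic_segment F d x y S"
  unfolding geodesic_segment_def by blast

lemma dist_to_set_isometric_image:
  assumes "\<And>u v. \<lbrakk>u \<in> A; v \<in> A\<rbrakk> \<Longrightarrow> dB (f u) (f v) = dA u v" "p \<in> A" "S \<subseteq> A"
  shows "dist_to_set dB (f p) (f ` S) = dist_to_set dA p S"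
  unfolding dist_to_set_def image_image using assms by (intro INF_cong) auto

lemma hyperbolic_space_isometric_preimage:
  assumes H: "hyperbolic_space \<delta> B dB" and A: "geodesic_metric_space A dA" and f: "f \<in> A \<rightarrow> B"
    and iso: "\<And>u v. \<lbrakk>u \<in> A; v \<in> A\<rbrakk> \<Longrightarrow> dB (f u) (f v) = dA u v"
  shows "hyperbolic_space \<delta> A dA"
proof -
  have "thin_sides dA \<delta> S1 S2 S3"
    if "x \<in> A" "y \<in> A" "z \<in> A"
      and S: "geodesic_segment A dA x y S1" "geodesic_segment A dA y z S2" "geodesic_segment A dA z x S3"
    for x y z S1 S2 S3
  proof -
    have "thin_sides dB \<delta> (f ` S1) (f ` S2) (f ` S3)"
      using H f that(1-3) geodesic_segment_isometric_image[OF S(1) f iso]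
        geodesic_segment_isometric_image[OF S(2) f iso] geodesic_segment_isometric_image[OF S(3) f iso]
      unfolding hyperbolic_space_def by blast
    moreover have A: "S1 \<subseteq> A" "S2 \<subseteq> A" "S3 \<subseteq> A"
      using S by (simp_all add: geodesic_segment_subset)
    have "dist_to_set dB (f p) (f ` T \<union> f ` U) = dist_to_set dA p (T \<union> U)"
      if "p \<in> A" "T \<subseteq> A" "U \<subseteq> A" for p T U
      unfolding image_Un[symmetric] using iso that by (intro dist_to_set_isometric_image) auto
    ultimately show ?thesis
      unfolding thin_sides_def by (simp add: A subsetD[OF A(1)] subsetD[OF A(2)] subsetD[OF A(3)])
  qed
  then show ?thesis
    using H A unfolding hyperbolic_space_def by blast
qed

text \<open>
  One stage leaves its new points unjoined; only the union over all stages contains a chosen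
  segment between any two of its points.
\<close>

primrec join_segments :: "('a \<Rightarrow> 'a \<Rightarrow> 'a set) \<Rightarrow> 'a set \<Rightarrow> nat \<Rightarrow> 'a set" where
  "join_segments seg X 0 = X"
| "join_segments seg X (Suc n) =
     join_segments seg X n \<union> (\<Union>(x, y) \<in> join_segments seg X n \<times> join_segments seg X n. seg x y)"

lemma join_segments_mono: "m \<le> n \<Longrightarrow> join_segments seg X m \<subseteq> join_segments seg X n"
  by (rule lift_Suc_mono_le[of "join_segments seg X"]) auto

lemma card_Un_le_continuum:
  includes cardinal_syntax
  assumes "|A| \<le>o |UNIV :: real set|" "|B| \<le>o |UNIV :: real set|"
  shows "|A \<union> B| \<le>o |UNIV :: real set|"
  using assms infinite_UNIV_char_0
  by (intro card_of_Un_ordLeq_infinite_Field card_of_Card_order) (simp_all add: Field_card_of)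

lemma geodesic_subspace_of_continuum_size:
  assumes E: "geodesic_metric_space E d" and X: "X \<subseteq> E" "inj_on (f :: 'a \<Rightarrow> real) X"
  obtains F and \<phi> :: "'a \<Rightarrow> real"
  where "X \<subseteq> F" "F \<subseteq> E" "geodesic_metric_space F d" "inj_on \<phi> F"
proof -
  include cardinal_syntax
  define seg where "seg x y = (SOME S. geodesic_segment E d x y S)" for x y
  have seg: "geodesic_segment E d x y (seg x y)" if "x \<in> E" "y \<in> E" for x y
    using that E unfolding seg_def geodesic_metric_space_def by (metis someI_ex)
  define F where "F = (\<Union>n. join_segments seg X n)"
  have sub: "join_segments seg X n \<subseteq> E" for n
  proof (induction n)
    case 0
    then show ?case using X(1) by simp
  next
    case (Suc n)
    have "seg x y \<subseteq> E" if "x \<in> join_segments seg X n" "y \<in> join_segments seg X n" for x y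
      using geodesic_segment_subset[OF seg] that Suc by blast
    with Suc show ?case by auto
  qed
  have "join_segments seg X 0 \<subseteq> F" unfolding F_def by blast
  then have F: "X \<subseteq> F" "F \<subseteq> E"
    using sub by (auto simp: F_def)
  have seg_F: "geodesic_segment F d x y (seg x y)" if xy: "x \<in> F" "y \<in> F" for x y
  proof -
    obtain m n where "x \<in> join_segments seg X m" "y \<in> join_segments seg X n"
      using xy by (auto simp: F_def)
    then have "x \<in> join_segments seg X (max m n)" "y \<in> join_segments seg X (max m n)"
      using join_segments_mono[of _ "max m n"] by (meson max.cobounded1 max.cobounded2 subsetD)+
    then have "seg x y \<subseteq> join_segments seg X (Suc (max m n))" by auto
    then have "seg x y \<subseteq> F" unfolding F_def by blast
    moreover have "x \<in> E" "y \<in> E" using xy F(2) by auto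
    ultimately show ?thesis using geodesic_segment_in_subspace[OF seg] by simp
  qed
  have geo: "geodesic_metric_space F d"
    using E seg_F Metric_space.subspace[OF _ F(2), of d]
    unfolding geodesic_metric_space_def by auto
  have inf: "infinite (UNIV :: real set)" by (rule infinite_UNIV_char_0)
  have seg_card: "|seg x y| \<le>o |UNIV :: real set|" if xy: "x \<in> E" "y \<in> E" for x y
  proof -
    obtain L and g :: "real \<Rightarrow> 'a" where "seg x y = g ` {0..L}"
      using seg[OF xy] unfolding geodesic_segment_def by blast
    then have "|seg x y| \<le>o |{0..L}|" by (simp add: card_of_image)
    moreover have "|{0..L}| \<le>o |UNIV :: real set|" by (rule card_of_mono1) simp
    ultimately show ?thesis by (rule ordLeq_transitive)
  qed
  have "|join_segments seg X n| \<le>o |UNIV :: real set|" for n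
  proof (induction n)
    case 0
    then show ?case using X(2) card_of_ordLeq[of X "UNIV :: real set"] by auto
  next
    case (Suc n)
    have "|join_segments seg X n \<times> join_segments seg X n| \<le>o |UNIV :: real set|"
      using Suc inf
      by (intro card_of_Times_ordLeq_infinite_Field card_of_Card_order) (simp_all add: Field_card_of)
    then have "|\<Union>(x, y) \<in> join_segments seg X n \<times> join_segments seg X n. seg x y| \<le>o |UNIV :: real set|"
      using seg_card sub[of n] by (intro card_of_UNION_ordLeq_infinite[OF inf]) auto
    then show ?case using Suc by (simp add: card_Un_le_continuum)
  qed
  moreover have "|UNIV :: nat set| \<le>o |UNIV :: real set|"
    using inf infinite_iff_card_of_nat by blast
  ultimately have "|F| \<le>o |UNIV :: real set|"
    unfolding F_def by (intro card_of_UNION_ordLeq_infinite[OF inf]) auto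
  then obtain \<phi> :: "'a \<Rightarrow> real" where "inj_on \<phi> F"
    using card_of_ordLeq[of F "UNIV :: real set"] by auto
  then show ?thesis using that F geo by blast
qed

text \<open>
  An injection \<open>\<phi>\<close> of such a subspace into the reals transports its metric to a set of reals.
\<close>

lemma near_geodesics_of_real_carriers:
  assumes real: "\<forall>(E :: real set) d. quasi_geodesics_near_geodesics A1 A2 E d"
  shows "quasi_geodesics_near_geodesics A1 A2 (E :: 'a set) d"
  unfolding quasi_geodesics_near_geodesics_def
proof (intro allI impI ballI)
  fix \<delta> \<Lambda> c l \<gamma> \<sigma> t
  assume H: "hyperbolic_space \<delta> E d" and Q: "quasi_geodesic \<Lambda> c E d l \<gamma>"
    and S: "geodesic_segment E d (\<gamma> 0) (\<gamma> l) \<sigma>" and t: "t \<in> {0..l}"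
  have E: "geodesic_metric_space E d" using H by (simp add: hyperbolic_space_def)
  interpret Metric_space E d using E by (simp add: geodesic_metric_space_def)
  obtain f :: "'a \<Rightarrow> real" where "inj_on f (\<gamma> ` {0..l} \<union> \<sigma>)"
  proof -
    include cardinal_syntax
    obtain L and g :: "real \<Rightarrow> 'a" where "\<sigma> = g ` {0..L}"
      using S unfolding geodesic_segment_def by blast
    moreover have "|k ` I| \<le>o |UNIV :: real set|" for k :: "real \<Rightarrow> 'a" and I
      by (rule ordLeq_transitive[OF card_of_image]) (simp add: card_of_mono1)
    ultimately have "|\<gamma> ` {0..l} \<union> \<sigma>| \<le>o |UNIV :: real set|"
      by (simp add: card_Un_le_continuum)
    then show ?thesis
      using that card_of_ordLeq[of "\<gamma> ` {0..l} \<union> \<sigma>" "UNIV :: real set"] by auto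
  qed
  moreover have "\<gamma> ` {0..l} \<union> \<sigma> \<subseteq> E"
    using Q geodesic_segment_subset[OF S] by (auto simp: quasi_geodesic_def quasi_isometry_def)
  ultimately obtain F and \<phi> :: "'a \<Rightarrow> real" where F: "\<gamma> ` {0..l} \<union> \<sigma> \<subseteq> F" "F \<subseteq> E"
      "geodesic_metric_space F d" and \<phi>: "inj_on \<phi> F"
    using geodesic_subspace_of_continuum_size[OF E] by blast
  define \<psi> where "\<psi> = inv_into F \<phi>"
  define E' where "E' = \<phi> ` F"
  define d' where "d' u v = d (\<psi> u) (\<psi> v)" for u v
  have \<psi>\<phi>: "\<psi> (\<phi> x) = x" if "x \<in> F" for x
    using that \<phi> by (simp add: \<psi>_def)
  have \<phi>\<psi>: "\<phi> (\<psi> u) = u" "\<psi> u \<in> F" if "u \<in> E'" for u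
    using that \<psi>\<phi> by (auto simp: E'_def)
  have iso: "d' (\<phi> x) (\<phi> y) = d x y" if "x \<in> F" "y \<in> F" for x y
    using that by (simp add: d'_def \<psi>\<phi>)
  have \<phi>_map: "\<phi> \<in> F \<rightarrow> E'" by (auto simp: E'_def)
  have "Metric_space E' d'"
  proof
    show "d' u v = 0 \<longleftrightarrow> u = v" if "u \<in> E'" "v \<in> E'" for u v
      using that \<phi>\<psi> F(2) unfolding d'_def by (metis subsetD zero)
    show "d' u x \<le> d' u v + d' v x" if "u \<in> E'" "v \<in> E'" "x \<in> E'" for u v x
      using that \<phi>\<psi>(2) F(2) unfolding d'_def by (meson subsetD triangle)
  qed (simp_all add: d'_def commute)
  moreover have "\<exists>S'. geodesic_segment E' d' u v S'" if uv: "u \<in> E'" "v \<in> E'" for u v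
  proof -
    obtain S' where "geodesic_segment F d (\<psi> u) (\<psi> v) S'"
      using F(3) \<phi>\<psi>(2) uv unfolding geodesic_metric_space_def by blast
    from geodesic_segment_isometric_image[OF this \<phi>_map, of d'] iso show ?thesis
      using \<phi>\<psi>(1) uv by auto
  qed
  ultimately have "geodesic_metric_space E' d'"
    by (simp add: geodesic_metric_space_def)
  then have "hyperbolic_space \<delta> E' d'"
    by (rule hyperbolic_space_isometric_preimage[OF H, of _ _ \<psi>]) (use \<phi>\<psi>(2) F(2) in \<open>auto simp: d'_def\<close>)
  moreover have "quasi_geodesic \<Lambda> c E' d' l (\<lambda>u. \<phi> (\<gamma> u))"
    using Q F(1) unfolding quasi_geodesic_def quasi_isometry_def
    by (auto simp: iso image_subset_iff E'_def)
  moreover have "geodesic_segment E' d' (\<phi> (\<gamma> 0)) (\<phi> (\<gamma> l)) (\<phi> ` \<sigma>)"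
    using geodesic_segment_isometric_image[OF geodesic_segment_in_subspace[OF S, of F] \<phi>_map, of d']
      F(1) iso by auto
  ultimately have "dist_to_set d' (\<phi> (\<gamma> t)) (\<phi> ` \<sigma>) \<le> \<Lambda>\<^sup>2 * (A1 * c + A2 * \<delta>)"
    using real t unfolding quasi_geodesics_near_geodesics_def by blast
  moreover have "dist_to_set d' (\<phi> (\<gamma> t)) (\<phi> ` \<sigma>) = dist_to_set d (\<gamma> t) \<sigma>"
    using F(1) t iso by (intro dist_to_set_isometric_image[of F]) auto
  ultimately show "dist_to_set d (\<gamma> t) \<sigma> \<le> \<Lambda>\<^sup>2 * (A1 * c + A2 * \<delta>)" by simp
qed

theorem theorem1:
  shows "(\<exists>A1 A2. \<forall>(E :: real set) d. quasi_geodesics_near_geodesics A1 A2 E d) \<and>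
         (\<forall>A1 A2. (\<forall>(E :: real set) d. quasi_geodesics_near_geodesics A1 A2 E d) \<longrightarrow>
                  (\<forall>(E :: 'a set) d. quasi_geodesics_near_geodesics A1 A2 E d))"
  using quasi_geodesic_near_geodesic near_geodesics_of_real_carriers by blast

end
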